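(* Let $\mathcal{D}$ be a dictionary of a Hilbert space $\mathcal{H}$ with coherence $M(\mathcal{D})\le\mu<1$, and let $\mathcal{D}_1\subset\mathcal{D}$ be a subdictionary with $M(\mathcal{D}_1)\le\mu_1<\mu$. Let $K\le L$ be natural numbers, $q\in(0,1)$, $0<a<b<\infty$, and assume that the inequalities $$ \mu\ge q(1-q)+\mu_1,\qquad a(1-q)>b(\mu+q\mu_1),\qquad \mu_1\le(1-q)q^{L-1} $$ are satisfied. Let $f\in E(K,L,q,a,b)$, that is, $$ f=\sum_{n=1}^L c_ng_n $$ with distinct elements $g_1,\dots,g_L\in\mathcal{D}_1$ and coefficients $c_n$ satisfying $aq^{n-1}\le|c_n|\le bq^{n-1}$ for $n=1,\dots,K$ and $|c_n|\le bq^{n-1}$ for $n=K+1,\dots,L$. Then, for the element $f$, the Pure Greedy Algorithm (with respect to $\mathcal{D}$) chooses the elements $g_1,g_2,\dots,g_K$ at the first $K$ iterations.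
   Context: A dictionary in a Hilbert space $\mathcal{H}$ is a system $\mathcal{D}$ of elements of $\mathcal{H}$ with $\|g\|\le1$ for all $g\in\mathcal{D}$ and with span dense in $\mathcal{H}$. The coherence of a system $\mathcal{D}$ is $M(\mathcal{D}):=\sup_{g\ne h;\,g,h\in\mathcal{D}}|\langle h,g\rangle|$. Pure Greedy Algorithm (PGA): $f_0:=f$; at iteration $m\ge1$ it chooses an element $g(f_{m-1})\in\mathcal{D}$ maximizing $|\langle f_{m-1},g\rangle|$ over $g\in\mathcal{D}$ (it is assumed for simplicity that a maximizer exists) and sets $f_m:=f_{m-1}-\langle f_{m-1},g(f_{m-1})\rangle g(f_{m-1})$.
   Formalization: The elements g_1,…,g_K are additionally assumed to have norm exactly 1 (with only norm at most 1 the claim is false, since a short g_1 can lose to another dictionary element); the Hilbert space is taken to be real. *)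

theory Defs
  imports "HOL-Analysis.Analysis"
begin

text \<open>Hilbert spaces are types of sort \<open>{real_inner, complete_space}\<close>.\<close>

definition dictionary :: "'a::real_inner set \<Rightarrow> bool" where
  "dictionary D \<longleftrightarrow> (\<forall>g\<in>D. norm g \<le> 1) \<and> closure (span D) = UNIV"

text \<open>Inserting \<open>0\<close> only matters for systems with at most one element, where the supremum over
  pairs of distinct elements is empty and is read as \<open>0\<close>. For subsets of a dictionary the set is
  bounded by \<open>1\<close>, so the real supremum is the intended one.\<close>

definition coherence :: "'a::real_inner set \<Rightarrow> real" where
  "coherence D = Sup (insert 0 {\<bar>inner h g\<bar> | g h. g \<in> D \<and> h \<in> D \<and> g \<noteq> h})"

text \<open>\<open>\<phi> m\<close> is the element chosen at iteration \<open>m \<ge> 1\<close> (the value \<open>\<phi> 0\<close> is irrelevant), and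
  \<open>pga_residual f \<phi> m\<close> is $f_m$.\<close>

primrec pga_residual :: "'a::real_inner \<Rightarrow> (nat \<Rightarrow> 'a) \<Rightarrow> nat \<Rightarrow> 'a" where
  "pga_residual f \<phi> 0 = f"
| "pga_residual f \<phi> (Suc m) =
     pga_residual f \<phi> m - inner (pga_residual f \<phi> m) (\<phi> (Suc m)) *\<^sub>R \<phi> (Suc m)"

text \<open>The maximizer need not be unique, so the algorithm is a relation: \<open>pga_run D f \<phi> N\<close> says that
  \<open>\<phi> 1, \<dots>, \<phi> N\<close> are admissible choices at the first \<open>N\<close> iterations.\<close>

definition pga_run :: "'a::real_inner set \<Rightarrow> 'a \<Rightarrow> (nat \<Rightarrow> 'a) \<Rightarrow> nat \<Rightarrow> bool" where
  "pga_run D f \<phi> N \<longleftrightarrow>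
     (\<forall>m\<in>{1..N}. is_arg_max (\<lambda>g. \<bar>inner (pga_residual f \<phi> (m - 1)) g\<bar>) (\<lambda>g. g \<in> D) (\<phi> m))"

end

theory Submission
  imports Defs
begin

text \<open>After \<open>m\<close> iterations that choose \<open>g\<^sub>1, \<dots>, g\<^sub>m\<close>, the residual is
  \<open>e\<^sub>1 g\<^sub>1 + \<dots> + e\<^sub>m g\<^sub>m + c\<^sub>m\<^sub>+\<^sub>1 g\<^sub>m\<^sub>+\<^sub>1 + \<dots> + c\<^sub>L g\<^sub>L\<close>. The leftover coefficient \<open>e\<^sub>n\<close>
  is at most \<open>\<mu>\<^sub>1\<close> times the sum of the absolute values of the other coefficients, so the bound on
  \<open>\<mu>\<^sub>1\<close> gives inductively \<open>\<bar>e\<^sub>n\<bar> \<le> b q\<^sup>L\<^sup>+\<^sup>n\<^sup>-\<^sup>1\<close>: after a cyclic rotation of the indices the residual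
  is again dominated by \<open>L\<close> consecutive terms of the geometric sequence \<open>b q\<^sup>i\<close>, starting at \<open>i = m\<close>.
  The remaining two inequalities then say that the inner product with \<open>g\<^sub>m\<^sub>+\<^sub>1\<close> strictly dominates
  that with every other element of the dictionary.\<close>

lemma abs_inner_le_coherence:
  assumes "\<forall>x\<in>D. norm x \<le> 1" and "g \<in> D" "h \<in> D" "g \<noteq> h"
  shows "\<bar>inner g h\<bar> \<le> coherence D"
  unfolding coherence_def
proof (rule cSup_upper)
  show "\<bar>inner g h\<bar> \<in> insert 0 {\<bar>inner h g\<bar> | g h. g \<in> D \<and> h \<in> D \<and> g \<noteq> h}"
    using assms by blast
  have "\<bar>inner y x\<bar> \<le> 1" if "x \<in> D" "y \<in> D" for x y
    using Cauchy_Schwarz_ineq2[of y x] mult_mono[of "norm y" 1 "norm x" 1] assms(1) that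
    by fastforce
  then show "bdd_above (insert 0 {\<bar>inner h g\<bar> | g h. g \<in> D \<and> h \<in> D \<and> g \<noteq> h})"
    by (intro bdd_aboveI[of _ 1]) auto
qed

lemma coherence_nonneg:
  assumes "\<forall>x\<in>D. norm x \<le> 1"
  shows "0 \<le> coherence D"
proof (cases "\<exists>g h. g \<in> D \<and> h \<in> D \<and> g \<noteq> h")
  case True
  then obtain g h where "g \<in> D" "h \<in> D" "g \<noteq> h" by blast
  with abs_inner_le_coherence[OF assms this] show ?thesis by linarith
next
  case False
  then have empty: "{\<bar>inner h g\<bar> | g h. g \<in> D \<and> h \<in> D \<and> g \<noteq> h} = {}" by blast
  show ?thesis unfolding coherence_def empty by simp
qed

lemma inner_sum_bound:
  fixes g :: "nat \<Rightarrow> 'a::real_inner"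
  assumes "\<And>n. n \<in> I \<Longrightarrow> \<bar>inner (g n) h\<bar> \<le> \<nu>"
  shows "\<bar>inner (\<Sum>n\<in>I. d n *\<^sub>R g n) h\<bar> \<le> \<nu> * (\<Sum>n\<in>I. \<bar>d n\<bar>)"
proof -
  have "\<bar>inner (\<Sum>n\<in>I. d n *\<^sub>R g n) h\<bar> = \<bar>\<Sum>n\<in>I. d n * inner (g n) h\<bar>"
    by (simp add: inner_sum_left)
  also have "\<dots> \<le> (\<Sum>n\<in>I. \<bar>d n * inner (g n) h\<bar>)" by (rule sum_abs)
  also have "\<dots> \<le> (\<Sum>n\<in>I. \<nu> * \<bar>d n\<bar>)"
    by (rule sum_mono) (metis abs_mult abs_ge_zero assms mult.commute mult_right_mono)
  finally show ?thesis by (simp add: sum_distrib_left)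
qed

lemma inner_sum_remainder_bound:
  fixes g :: "nat \<Rightarrow> 'a::real_inner"
  assumes "finite I" "k \<in> I" and "\<And>n. n \<in> I - {k} \<Longrightarrow> \<bar>inner (g n) h\<bar> \<le> \<nu>"
  shows "\<bar>inner (\<Sum>n\<in>I. d n *\<^sub>R g n) h - d k * inner (g k) h\<bar> \<le> \<nu> * (\<Sum>n\<in>I - {k}. \<bar>d n\<bar>)"
  using inner_sum_bound[of "I - {k}" g h \<nu> d] assms(3)
  by (simp add: sum.remove[OF assms(1,2)] inner_add_left)

text \<open>For \<open>m < L\<close> the values on \<open>{1..L}\<close> are
  \<open>m, ..., m + L - 1\<close>, each taken once: \<open>Suc m\<close> gets the smallest, and
  indices up to \<open>m\<close> are counted as if they came after \<open>L\<close>.\<close>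

definition rotated_index :: "nat \<Rightarrow> nat \<Rightarrow> nat \<Rightarrow> nat" where
  "rotated_index L m n = (if n \<le> m then L - 1 + n else n - 1)"

text \<open>The sum over all of \<open>{1..L}\<close> runs through \<open>L\<close> consecutive
  powers from \<open>q ^ m\<close> on, so it is at most \<open>q ^ m / (1 - q)\<close>; the omitted
  index carries exactly the first term \<open>q ^ m\<close>.\<close>

lemma sum_rotated_powers:
  fixes q :: real
  assumes "0 < q" "q < 1" "m < L"
  shows "(\<Sum>n\<in>{1..L} - {Suc m}. q ^ rotated_index L m n) \<le> q ^ Suc m / (1 - q)"
proof -
  have "(\<Sum>n = 1..L. q ^ rotated_index L m n) = (\<Sum>i\<in>{m..<m + L}. q ^ i)"
    \<comment> \<open>The inverse rotation: exponents below \<open>L\<close> come from indices above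
      \<open>m\<close>, the others from indices up to \<open>m\<close>.\<close>
    by (rule sum.reindex_bij_witness[of _ "\<lambda>i. if i < L then i + 1 else i + 1 - L"
          "rotated_index L m"])
      (use assms(3) in \<open>auto simp: rotated_index_def split: if_splits\<close>)
  also have "\<dots> = q ^ m * (\<Sum>i<L. q ^ i)"
    using sum.shift_bounds_nat_ivl[of "\<lambda>i. q ^ i" 0 m L]
    by (simp add: sum_distrib_left power_add mult.commute add.commute lessThan_atLeast0)
  also have "\<dots> \<le> q ^ m * (1 / (1 - q))"
    using assms by (intro mult_left_mono) (simp_all add: sum_gp_strict divide_right_mono)
  finally have "(\<Sum>n = 1..L. q ^ rotated_index L m n) \<le> q ^ m / (1 - q)" by simp
  moreover have "(\<Sum>n = 1..L. q ^ rotated_index L m n) =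
      q ^ m + (\<Sum>n\<in>{1..L} - {Suc m}. q ^ rotated_index L m n)"
    using assms(3) by (subst sum.remove[of _ "Suc m"]) (auto simp: rotated_index_def)
  moreover have "q ^ m / (1 - q) - q ^ m = q ^ Suc m / (1 - q)"
    using assms by (simp add: field_simps)
  ultimately show ?thesis by linarith
qed

lemma pga_residual_cong:
  assumes "\<And>i. i \<in> {1..m} \<Longrightarrow> \<phi> i = \<psi> i"
  shows "pga_residual f \<phi> m = pga_residual f \<psi> m"
  using assms by (induction m) auto

text \<open>A residual depends only on earlier choices, so strict maximality along the residuals of
  \<open>g\<close> itself is enough: strong induction forces every other run to agree with
  \<open>g\<close>.\<close>

lemma pga_run_unique:
  assumes strict: "\<And>m h. m < K \<Longrightarrow> h \<in> D \<Longrightarrow> h \<noteq> g (Suc m) \<Longrightarrow>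
      \<bar>inner (pga_residual f g m) h\<bar> < \<bar>inner (pga_residual f g m) (g (Suc m))\<bar>"
    and dict: "g ` {1..K} \<subseteq> D"
  shows "pga_run D f g K \<and> (\<forall>\<phi>. pga_run D f \<phi> K \<longrightarrow> (\<forall>m\<in>{1..K}. \<phi> m = g m))"
proof (intro conjI allI impI ballI)
  show "pga_run D f g K"
    unfolding pga_run_def
  proof
    fix m assume m: "m \<in> {1..K}"
    then have "m - 1 < K" "Suc (m - 1) = m" by auto
    then have "\<bar>inner (pga_residual f g (m - 1)) h\<bar> \<le> \<bar>inner (pga_residual f g (m - 1)) (g m)\<bar>"
      if "h \<in> D" for h
      using strict[of "m - 1" h] that by (cases "h = g m") auto
    then show "is_arg_max (\<lambda>x. \<bar>inner (pga_residual f g (m - 1)) x\<bar>) (\<lambda>x. x \<in> D) (g m)"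
      using m dict by (auto simp: is_arg_max_linorder)
  qed
next
  fix \<phi> m
  assume run: "pga_run D f \<phi> K" and "m \<in> {1..K}"
  from this(2) show "\<phi> m = g m"
  proof (induction m rule: less_induct)
    case (less m)
    then have m: "m - 1 < K" "Suc (m - 1) = m" by auto
    have res: "pga_residual f \<phi> (m - 1) = pga_residual f g (m - 1)"
      by (rule pga_residual_cong) (use less in auto)
    have "is_arg_max (\<lambda>x. \<bar>inner (pga_residual f g (m - 1)) x\<bar>) (\<lambda>x. x \<in> D) (\<phi> m)"
      using run less.prems unfolding pga_run_def res[symmetric] by blast
    moreover have "g m \<in> D" using less.prems dict by blast
    ultimately show ?case
      using strict[of "m - 1" "\<phi> m"] m by (fastforce simp: is_arg_max_linorder)
  qed
qed

theorem theorem4p1: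
  fixes D D\<^sub>1 :: "'a::{real_inner, complete_space} set"
    and \<mu> \<mu>\<^sub>1 q a b :: real
    and K L :: nat
    and f :: 'a
    and g :: "nat \<Rightarrow> 'a"
    and c :: "nat \<Rightarrow> real"
  assumes "dictionary D"
    and "coherence D \<le> \<mu>" and "\<mu> < 1"
    and "D\<^sub>1 \<subseteq> D"
    and "coherence D\<^sub>1 \<le> \<mu>\<^sub>1" and "\<mu>\<^sub>1 < \<mu>"
    and "1 \<le> K" and "K \<le> L"
    and "0 < q" and "q < 1"
    and "0 < a" and "a < b"
    and "\<mu> \<ge> q * (1 - q) + \<mu>\<^sub>1"
    and "a * (1 - q) > b * (\<mu> + q * \<mu>\<^sub>1)"
    and "\<mu>\<^sub>1 \<le> (1 - q) * q ^ (L - 1)"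
    and "f = (\<Sum>n = 1..L. c n *\<^sub>R g n)"
    and "g ` {1..L} \<subseteq> D\<^sub>1" and "inj_on g {1..L}"
    and "\<And>n. n \<in> {1..K} \<Longrightarrow> a * q ^ (n - 1) \<le> \<bar>c n\<bar> \<and> \<bar>c n\<bar> \<le> b * q ^ (n - 1)"
    and "\<And>n. n \<in> {K + 1..L} \<Longrightarrow> \<bar>c n\<bar> \<le> b * q ^ (n - 1)"
    and normalized: "\<And>n. n \<in> {1..K} \<Longrightarrow> norm (g n) = 1"
  shows "pga_run D f g K \<and> (\<forall>\<phi>. pga_run D f \<phi> K \<longrightarrow> (\<forall>m\<in>{1..K}. \<phi> m = g m))"
proof -
  note dict = assms(1) and sub = assms(4) and KL = assms(8) and q = assms(9,10)
    and ab = assms(11,12) and f = assms(16) and gD\<^sub>1 = assms(17) and inj = assms(18)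
  have b: "0 < b" using ab by simp
  have gD: "g n \<in> D" if "n \<in> {1..L}" for n
    using gD\<^sub>1 sub that by blast
  have norm_le: "\<forall>x\<in>D. norm x \<le> 1"
    using dict by (simp add: dictionary_def)
  then have norm_le\<^sub>1: "\<forall>x\<in>D\<^sub>1. norm x \<le> 1"
    using sub by blast
  have \<mu>\<^sub>1: "0 \<le> \<mu>\<^sub>1"
    using coherence_nonneg[OF norm_le\<^sub>1] assms(5) by linarith
  have coh: "\<bar>inner x y\<bar> \<le> \<mu>" if "x \<in> D" "y \<in> D" "x \<noteq> y" for x y
    using abs_inner_le_coherence[OF norm_le that] assms(2) by linarith
  have coh\<^sub>1: "\<bar>inner (g i) (g j)\<bar> \<le> \<mu>\<^sub>1" if "i \<in> {1..L}" "j \<in> {1..L}" "i \<noteq> j" for i j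
  proof -
    have "g i \<noteq> g j" using inj that by (auto dest: inj_onD)
    then show ?thesis
      using abs_inner_le_coherence[OF norm_le\<^sub>1, of "g i" "g j"] gD\<^sub>1 that assms(5) by fastforce
  qed
  \<comment> \<open>Unit norm makes the inner product of a combination with \<open>g n\<close>
    return the coefficient of \<open>g n\<close> up to cross terms.\<close>
  have self: "inner (g n) (g n) = 1" if "n \<in> {1..K}" for n
    using normalized[OF that] by (simp add: norm_eq_1)
  have self_le: "\<bar>inner (g n) (g n)\<bar> \<le> 1" if "n \<in> {1..L}" for n
  proof -
    have "norm (g n) \<le> 1" using norm_le\<^sub>1 gD\<^sub>1 that by blast
    then show ?thesis by (simp add: dot_square_norm power_le_one)
  qed
  have cbound: "\<bar>c n\<bar> \<le> b * q ^ (n - 1)" if "n \<in> {1..L}" for n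
    using assms(19)[of n] assms(20)[of n] that by (cases "n \<le> K") auto
  let ?R = "\<lambda>m. b * q ^ Suc m / (1 - q)"
  have tail: "(\<Sum>n\<in>{1..L} - {Suc m}. \<bar>d n\<bar>) \<le> ?R m"
    if "m < L" and d: "\<And>n. n \<in> {1..L} \<Longrightarrow> \<bar>d n\<bar> \<le> b * q ^ rotated_index L m n" for d m
  proof -
    have "(\<Sum>n\<in>{1..L} - {Suc m}. \<bar>d n\<bar>) \<le> (\<Sum>n\<in>{1..L} - {Suc m}. b * q ^ rotated_index L m n)"
      by (rule sum_mono) (use d in auto)
    also have "\<dots> \<le> b * (q ^ Suc m / (1 - q))"
      unfolding sum_distrib_left[symmetric]
      using sum_rotated_powers[OF q that(1)] b by (intro mult_left_mono) auto
    finally show ?thesis by simp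
  qed
  \<comment> \<open>The last conjunct hands the lower bound \<open>a * q ^ m\<close> on
    \<open>c (Suc m)\<close> to the next iteration.\<close>
  have rep: "\<exists>d. pga_residual f g m = (\<Sum>n = 1..L. d n *\<^sub>R g n) \<and>
      (\<forall>n\<in>{1..L}. \<bar>d n\<bar> \<le> b * q ^ rotated_index L m n) \<and> (\<forall>n>m. d n = c n)" if "m \<le> K" for m
    using that
  proof (induction m)
    case 0
    then show ?case
      using f cbound by (intro exI[of _ c]) (auto simp: rotated_index_def)
  next
    case (Suc m)
    then obtain d where v: "pga_residual f g m = (\<Sum>n = 1..L. d n *\<^sub>R g n)"
      and d: "\<And>n. n \<in> {1..L} \<Longrightarrow> \<bar>d n\<bar> \<le> b * q ^ rotated_index L m n"
      and dc: "\<And>n. n > m \<Longrightarrow> d n = c n"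
      by auto
    let ?k = "Suc m"
    have k: "?k \<in> {1..L}" "?k \<in> {1..K}" "m < L" using Suc.prems KL by auto
    \<comment> \<open>The coefficient of \<open>g ?k\<close> after the iteration. By unit norm
      \<open>d ?k\<close> cancels, leaving only cross terms.\<close>
    define e where "e = d ?k - inner (pga_residual f g m) (g ?k)"
    have "\<bar>e\<bar> \<le> \<mu>\<^sub>1 * (\<Sum>n\<in>{1..L} - {?k}. \<bar>d n\<bar>)"
      using inner_sum_remainder_bound[of "{1..L}" ?k g "g ?k" \<mu>\<^sub>1 d] coh\<^sub>1 k self[OF k(2)]
      unfolding e_def v by (auto simp: abs_minus_commute)
    also have "\<dots> \<le> \<mu>\<^sub>1 * ?R m"
      using tail[OF k(3) d] \<mu>\<^sub>1 by (rule mult_left_mono)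
    \<comment> \<open>The factor \<open>1 - q\<close> in the bound on \<open>\<mu>\<^sub>1\<close>
      cancels the geometric denominator, and \<open>q ^ (L - 1)\<close> lifts the exponent to the
      one that \<open>rotated_index L ?k\<close> assigns to \<open>?k\<close>.\<close>
    also have "\<dots> \<le> (1 - q) * q ^ (L - 1) * ?R m"
      using assms(15) b q by (intro mult_right_mono) auto
    also have "\<dots> = b * q ^ (L - 1 + ?k)"
      using q by (simp add: power_add)
    finally have e: "\<bar>e\<bar> \<le> b * q ^ (L - 1 + ?k)" .
    have "pga_residual f g m = d ?k *\<^sub>R g ?k + (\<Sum>n\<in>{1..L} - {?k}. d n *\<^sub>R g n)"
      unfolding v by (rule sum.remove[OF _ k(1)]) simp
    moreover have "(\<Sum>n = 1..L. (d(?k := e)) n *\<^sub>R g n) =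
        e *\<^sub>R g ?k + (\<Sum>n\<in>{1..L} - {?k}. d n *\<^sub>R g n)"
      by (subst sum.remove[OF _ k(1)]) auto
    ultimately have "pga_residual f g ?k = (\<Sum>n = 1..L. (d(?k := e)) n *\<^sub>R g n)"
      by (simp add: e_def scaleR_diff_left)
    \<comment> \<open>Passing from \<open>m\<close> to \<open>?k\<close> changes the rotated
      exponent of \<open>?k\<close> alone.\<close>
    moreover have "\<bar>(d(?k := e)) n\<bar> \<le> b * q ^ rotated_index L ?k n" if "n \<in> {1..L}" for n
      using d[OF that] e by (auto simp: rotated_index_def split: if_splits)
    ultimately show ?case
      using dc by (intro exI[of _ "d(?k := e)"]) auto
  qed
  have strict: "\<bar>inner (pga_residual f g m) h\<bar> < \<bar>inner (pga_residual f g m) (g (Suc m))\<bar>"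
    if m: "m < K" and h: "h \<in> D" "h \<noteq> g (Suc m)" for m h
  proof -
    obtain d where v: "pga_residual f g m = (\<Sum>n = 1..L. d n *\<^sub>R g n)"
      and d: "\<And>n. n \<in> {1..L} \<Longrightarrow> \<bar>d n\<bar> \<le> b * q ^ rotated_index L m n"
      and dc: "\<And>n. n > m \<Longrightarrow> d n = c n"
      using rep[of m] m by auto
    let ?k = "Suc m" and ?v = "pga_residual f g m" and ?S = "b * q ^ m / (1 - q)"
    have k: "?k \<in> {1..L}" "?k \<in> {1..K}" "m < L" using m KL by auto
    have dk: "a * q ^ m \<le> \<bar>d ?k\<bar>" "\<bar>d ?k\<bar> \<le> b * q ^ m"
      using assms(19)[OF k(2)] dc by auto
    have R: "b * q ^ m + ?R m = ?S" using q by (simp add: field_simps)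
    have total: "(\<Sum>n = 1..L. \<bar>d n\<bar>) \<le> ?S"
      using tail[OF k(3) d] dk(2) R by (subst sum.remove[OF _ k(1)]) auto
    have "\<bar>inner ?v (g ?k) - d ?k\<bar> \<le> \<mu>\<^sub>1 * (\<Sum>n\<in>{1..L} - {?k}. \<bar>d n\<bar>)"
      using inner_sum_remainder_bound[of "{1..L}" ?k g "g ?k" \<mu>\<^sub>1 d] coh\<^sub>1 k self[OF k(2)]
      unfolding v by auto
    also have "\<dots> \<le> \<mu>\<^sub>1 * ?R m"
      using tail[OF k(3) d] \<mu>\<^sub>1 by (rule mult_left_mono)
    finally have lower: "a * q ^ m - \<mu>\<^sub>1 * ?R m \<le> \<bar>inner ?v (g ?k)\<bar>"
      using dk(1) by linarith
    have upper: "\<bar>inner ?v h\<bar> \<le> \<mu> * ?S"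
    \<comment> \<open>For \<open>h\<close> outside the system every term costs a factor \<mu>; for
      \<open>h = g j\<close> one term has no small factor, but all others cost only
      \<open>\<mu>\<^sub>1\<close>.\<close>
    proof (cases "h \<in> g ` {1..L}")
      case False
      then have "\<bar>inner ?v h\<bar> \<le> \<mu> * (\<Sum>n = 1..L. \<bar>d n\<bar>)"
        unfolding v using h(1) gD by (intro inner_sum_bound coh) auto
      also have "\<dots> \<le> \<mu> * ?S"
        using total \<mu>\<^sub>1 assms(6) by (intro mult_left_mono) auto
      finally show ?thesis .
    next
      case True
      then obtain j where j: "j \<in> {1..L}" "h = g j" by blast
      then have "j \<noteq> ?k" using h(2) by blast
      \<comment> \<open>Only \<open>?k\<close> has exponent \<open>m\<close>: later indices have
        larger exponents, and earlier ones have at least \<open>L\<close>, which exceeds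
        \<open>m\<close>.\<close>
      then have "?k \<le> rotated_index L m j"
        using j(1) k(3) by (auto simp: rotated_index_def)
      then have "b * q ^ rotated_index L m j \<le> b * q ^ ?k"
        using q b by (intro mult_left_mono power_decreasing) auto
      then have dj: "\<bar>d j\<bar> \<le> b * q ^ ?k" using d[OF j(1)] by linarith
      have "\<bar>d j * inner (g j) h\<bar> \<le> \<bar>d j\<bar> * 1"
        unfolding abs_mult j(2) using self_le[OF j(1)] by (intro mult_left_mono) auto
      moreover have "\<bar>inner ?v h - d j * inner (g j) h\<bar> \<le> \<mu>\<^sub>1 * (\<Sum>n\<in>{1..L} - {j}. \<bar>d n\<bar>)"
        unfolding v j(2) using j(1) coh\<^sub>1 by (intro inner_sum_remainder_bound) auto
      moreover have "\<mu>\<^sub>1 * (\<Sum>n\<in>{1..L} - {j}. \<bar>d n\<bar>) \<le> \<mu>\<^sub>1 * ?S"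
        using total \<mu>\<^sub>1 sum_mono2[of "{1..L}" "{1..L} - {j}" "\<lambda>n. \<bar>d n\<bar>"]
        by (intro mult_left_mono) auto
      ultimately have "\<bar>inner ?v h\<bar> \<le> b * q ^ ?k + \<mu>\<^sub>1 * ?S"
        using dj by linarith
      \<comment> \<open>Here \<open>b * q ^ ?k\<close> is rewritten as
        \<open>q * (1 - q) * ?S\<close>, the origin of \<open>q * (1 - q)\<close> in the condition
        on \<mu>.\<close>
      also have "\<dots> = (q * (1 - q) + \<mu>\<^sub>1) * ?S"
        using q by (simp add: field_simps)
      also have "\<dots> \<le> \<mu> * ?S"
        using assms(13) b q by (intro mult_right_mono) auto
      finally show ?thesis .
    qed
    \<comment> \<open>The bound for competitors plus the loss in \<open>lower\<close> has the common
      factor \<open>q ^ m / (1 - q)\<close>, so one inequality between \<open>a\<close> and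
      \<open>b\<close> gives strictness at every iteration.\<close>
    have "\<mu> * ?S + \<mu>\<^sub>1 * ?R m = b * (\<mu> + q * \<mu>\<^sub>1) * (q ^ m / (1 - q))"
      by (simp add: algebra_simps add_divide_distrib)
    also have "\<dots> < a * (1 - q) * (q ^ m / (1 - q))"
      using assms(14) q by (intro mult_strict_right_mono) auto
    also have "\<dots> = a * q ^ m" using q by simp
    finally show ?thesis using lower upper by linarith
  qed
  show ?thesis
    by (rule pga_run_unique[OF strict]) (use gD KL in auto)
qed

end
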